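(* Let $G$ be a group with a non-trivial central element $z$ whose order is a prime power which is not a prime. Suppose that $z$ is semi-regular. Then $G$ has a non-trivial set-direct factorization. Furthermore, if $G$ is also perfect, then $G$ has a non-trivial normalized set-direct factorization such that none of the factors is a group.
   Context: Groups may be infinite. A subset of a group $G$ is normal if it is invariant under conjugation by all elements of $G$. A set-direct factorization $G=X\times Y$ consists of non-empty normal subsets $X,Y$ of $G$ such that every $g\in G$ has a unique representation $g=xy$ with $x\in X$ and $y\in Y$. It is non-trivial if none of $X$ or $Y$ is a singleton consisting of a central element; it is normalized if $1_G\in X$ and $1_G\in Y$. A factor "is a group" if it is a subgroup of $G$. A central element $z\in Z(G)$ is semi-regular if $zC\neq C$ for every conjugacy class $C$ of $G$. *)

theory Defs
  imports "HOL-Algebra.Multiplicative_Group" "HOL-Algebra.Group_Action"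
    "HOL-Algebra.Generated_Groups" "HOL-Number_Theory.Prime_Powers"
begin

definition center :: "('a, 'b) monoid_scheme \<Rightarrow> 'a set" where
  "center G = {z \<in> carrier G. \<forall>g \<in> carrier G. z \<otimes>\<^bsub>G\<^esub> g = g \<otimes>\<^bsub>G\<^esub> z}"

definition conjugacy_classes :: "('a, 'b) monoid_scheme \<Rightarrow> 'a set set" where
  "conjugacy_classes G =
     orbits G (carrier G) (\<lambda>g. \<lambda>h \<in> carrier G. g \<otimes>\<^bsub>G\<^esub> h \<otimes>\<^bsub>G\<^esub> inv\<^bsub>G\<^esub> g)"

definition normal_subset :: "('a, 'b) monoid_scheme \<Rightarrow> 'a set \<Rightarrow> bool" where
  "normal_subset G X \<longleftrightarrow>
     X \<subseteq> carrier G \<and> (\<forall>g \<in> carrier G. g <#\<^bsub>G\<^esub> X #>\<^bsub>G\<^esub> (inv\<^bsub>G\<^esub> g) = X)"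

definition set_direct_factorization ::
    "('a, 'b) monoid_scheme \<Rightarrow> 'a set \<Rightarrow> 'a set \<Rightarrow> bool" where
  "set_direct_factorization G X Y \<longleftrightarrow>
     X \<noteq> {} \<and> Y \<noteq> {} \<and> normal_subset G X \<and> normal_subset G Y \<and>
     (\<forall>g \<in> carrier G. \<exists>!(x, y). x \<in> X \<and> y \<in> Y \<and> g = x \<otimes>\<^bsub>G\<^esub> y)"

definition nontrivial_factorization ::
    "('a, 'b) monoid_scheme \<Rightarrow> 'a set \<Rightarrow> 'a set \<Rightarrow> bool" where
  "nontrivial_factorization G X Y \<longleftrightarrow>
     set_direct_factorization G X Y \<and>
     \<not> (\<exists>c \<in> center G. X = {c}) \<and> \<not> (\<exists>c \<in> center G. Y = {c})"

definition normalized_factorization ::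
    "('a, 'b) monoid_scheme \<Rightarrow> 'a set \<Rightarrow> 'a set \<Rightarrow> bool" where
  "normalized_factorization G X Y \<longleftrightarrow>
     set_direct_factorization G X Y \<and> \<one>\<^bsub>G\<^esub> \<in> X \<and> \<one>\<^bsub>G\<^esub> \<in> Y"

definition semi_regular :: "('a, 'b) monoid_scheme \<Rightarrow> 'a \<Rightarrow> bool" where
  "semi_regular G z \<longleftrightarrow>
     z \<in> center G \<and> (\<forall>C \<in> conjugacy_classes G. z <#\<^bsub>G\<^esub> C \<noteq> C)"

definition perfect_group :: "('a, 'b) monoid_scheme \<Rightarrow> bool" where
  "perfect_group G \<longleftrightarrow> group G \<and> derived G (carrier G) = carrier G"

end

theory Submission
  imports Defs "HOL-Number_Theory.Cong"
begin

text \<open>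
  Let \<open>z\<close> have order \<open>p\<^sup>n\<close> with \<open>n \<ge> 2\<close>. Semi-regularity says that the stabiliser in
  \<open>\<langle>z\<rangle>\<close> of each conjugacy class lies in \<open>\<langle>z\<^sup>p\<rangle>\<close>. Hence one can choose a class in each
  \<open>\<langle>z\<rangle>\<close>-orbit of classes, and \<open>X = {1, z, \<dots>, z\<^sup>p\<^sup>-\<^sup>1}\<close> together with the union \<open>Y\<close> of all
  \<open>\<langle>z\<^sup>p\<rangle>\<close>-translates of the chosen classes is a factorization, normalized if the class of \<open>1\<close>
  is chosen. As \<open>n \<ge> 2\<close>, \<open>X\<close> is not a subgroup and \<open>Y\<close> is not a singleton. If \<open>Y\<close> is a
  subgroup, then \<open>G = XY\<close> with \<open>X\<close> central, so \<open>Y\<close> contains all commutators and \<open>G\<close> is not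
  perfect.
\<close>

section \<open>Conjugacy modulo powers of \<open>z\<close>, and the two factors\<close>

definition conj_by :: "('a, 'b) monoid_scheme \<Rightarrow> 'a \<Rightarrow> 'a \<Rightarrow> 'a" where
  "conj_by G x g = x \<otimes>\<^bsub>G\<^esub> g \<otimes>\<^bsub>G\<^esub> inv\<^bsub>G\<^esub> x"

text \<open>For central \<open>z\<close> this is the orbit relation of
  \<open>\<langle>z\<rangle>\<close> and conjugation acting together: an equivalence class is the
  union of one \<open>\<langle>z\<rangle>\<close>-orbit of conjugacy classes.\<close>

definition conj_modulo :: "('a, 'b) monoid_scheme \<Rightarrow> 'a \<Rightarrow> 'a \<Rightarrow> 'a \<Rightarrow> bool" where
  "conj_modulo G z g h \<longleftrightarrow>
     (\<exists>k::int. \<exists>x \<in> carrier G. h = z [^]\<^bsub>G\<^esub> k \<otimes>\<^bsub>G\<^esub> conj_by G x g)"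

text \<open>The separate case makes \<open>\<one>\<close> the representative of its own orbit, which
  puts \<open>\<one>\<close> into \<open>class_factor\<close> and so normalizes the
  factorization.\<close>

definition class_rep :: "('a, 'b) monoid_scheme \<Rightarrow> 'a \<Rightarrow> 'a \<Rightarrow> 'a" where
  "class_rep G z g =
     (if conj_modulo G z g \<one>\<^bsub>G\<^esub> then \<one>\<^bsub>G\<^esub> else (SOME h. conj_modulo G z g h))"

definition power_factor :: "('a, 'b) monoid_scheme \<Rightarrow> 'a \<Rightarrow> nat \<Rightarrow> 'a set" where
  "power_factor G z p = {z [^]\<^bsub>G\<^esub> i | i::int. 0 \<le> i \<and> i < int p}"

text \<open>The representative is that of \<open>y\<close> itself, so the union over all orbits of
  classes needs no index set. The price is that membership proofs must first identify
  \<open>class_rep G z y\<close>.\<close>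

definition class_factor :: "('a, 'b) monoid_scheme \<Rightarrow> 'a \<Rightarrow> nat \<Rightarrow> 'a set" where
  "class_factor G z p = {y \<in> carrier G. \<exists>k::int. \<exists>x \<in> carrier G.
     y = z [^]\<^bsub>G\<^esub> (int p * k) \<otimes>\<^bsub>G\<^esub> conj_by G x (class_rep G z y)}"

context group
begin

section \<open>Conjugation, the center and normal subsets\<close>

lemma conj_by_closed [simp, intro]:
  "x \<in> carrier G \<Longrightarrow> g \<in> carrier G \<Longrightarrow> conj_by G x g \<in> carrier G"
  by (simp add: conj_by_def)

lemma conj_by_mult:
  assumes "x \<in> carrier G" "y \<in> carrier G" "g \<in> carrier G"
  shows "conj_by G (x \<otimes> y) g = conj_by G x (conj_by G y g)"
  using assms by (simp add: conj_by_def inv_mult_group m_assoc)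

lemma conj_by_one [simp]: "g \<in> carrier G \<Longrightarrow> conj_by G \<one> g = g"
  by (simp add: conj_by_def)

lemma conj_by_to_one [simp]: "x \<in> carrier G \<Longrightarrow> conj_by G x \<one> = \<one>"
  by (simp add: conj_by_def)

lemma centerD:
  assumes "c \<in> center G"
  shows "c \<in> carrier G" and "g \<in> carrier G \<Longrightarrow> c \<otimes> g = g \<otimes> c"
  using assms by (auto simp: center_def)

lemma conj_by_center_mult:
  assumes c: "c \<in> center G" and "x \<in> carrier G" "g \<in> carrier G"
  shows "conj_by G x (c \<otimes> g) = c \<otimes> conj_by G x g"
proof -
  have "x \<otimes> (c \<otimes> g) = c \<otimes> (x \<otimes> g)"
    using assms centerD[OF c] by (metis m_assoc)
  then show ?thesis
    using assms centerD(1)[OF c] by (simp add: conj_by_def m_assoc)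
qed

lemma conj_by_center:
  assumes "c \<in> center G" "x \<in> carrier G"
  shows "conj_by G x c = c"
  using conj_by_center_mult[OF assms(1,2) one_closed] centerD(1)[OF assms(1)] assms(2) by simp

lemma subgroup_center: "subgroup (center G) G"
proof
  show "center G \<subseteq> carrier G" "\<one> \<in> center G"
    by (auto simp: center_def)
  fix x assume x: "x \<in> center G"
  note xc = centerD(1)[OF x]
  show "x \<otimes> y \<in> center G" if y: "y \<in> center G" for y
    unfolding center_def
  proof (intro CollectI conjI ballI)
    note yc = centerD(1)[OF y]
    show "x \<otimes> y \<in> carrier G" using xc yc by simp
    fix g assume g: "g \<in> carrier G"
    have "x \<otimes> y \<otimes> g = x \<otimes> (g \<otimes> y)"
      using xc yc g centerD(2)[OF y g] by (simp add: m_assoc)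
    also have "\<dots> = g \<otimes> x \<otimes> y"
      using xc yc g by (simp add: m_assoc[symmetric] centerD(2)[OF x g])
    finally show "x \<otimes> y \<otimes> g = g \<otimes> (x \<otimes> y)"
      using xc yc g by (simp add: m_assoc)
  qed
  show "inv x \<in> center G"
    unfolding center_def
  proof (intro CollectI conjI ballI)
    show "inv x \<in> carrier G" using xc by simp
    fix g assume g: "g \<in> carrier G"
    have "g = x \<otimes> (g \<otimes> inv x)"
      using xc g by (simp add: m_assoc[symmetric] centerD(2)[OF x g]) (simp add: m_assoc)
    then have "inv x \<otimes> g = inv x \<otimes> (x \<otimes> (g \<otimes> inv x))"
      by (rule arg_cong)
    also have "\<dots> = inv x \<otimes> x \<otimes> (g \<otimes> inv x)"
      using xc g by (simp only: m_assoc m_closed inv_closed)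
    finally show "inv x \<otimes> g = g \<otimes> inv x"
      using xc g by simp
  qed
qed

lemma center_int_pow: "z \<in> center G \<Longrightarrow> z [^] (k::int) \<in> center G"
  by (rule subgroup_int_pow_closed[OF subgroup_center])

text \<open>Closure under conjugation by \<open>g\<close> gives one inclusion and closure under
  conjugation by \<open>inv g\<close> the other, so closure alone suffices for invariance.\<close>

lemma normal_subsetI:
  assumes X: "X \<subseteq> carrier G"
    and closed: "\<And>x g. x \<in> X \<Longrightarrow> g \<in> carrier G \<Longrightarrow> conj_by G g x \<in> X"
  shows "normal_subset G X"
  unfolding normal_subset_def
proof (intro conjI ballI X)
  fix g assume g: "g \<in> carrier G"
  have eq: "g <# X #> inv g = conj_by G g ` X"
    by (auto simp: l_coset_def r_coset_def conj_by_def)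
  have "X \<subseteq> conj_by G g ` X"
  proof
    fix x assume x: "x \<in> X"
    have "x = conj_by G g (conj_by G (inv g) x)"
      using x X g by (subst conj_by_mult[symmetric]) auto
    then show "x \<in> conj_by G g ` X"
      using closed[OF x inv_closed[OF g]] by blast
  qed
  then show "g <# X #> inv g = X"
    using closed g by (auto simp: eq)
qed

lemma conj_by_inv_eq:
  assumes "x \<in> carrier G" "g \<in> carrier G" "h \<in> carrier G" "h = conj_by G x g"
  shows "conj_by G (inv x) h = g"
  using assms by (simp add: conj_by_mult[symmetric])

section \<open>Powers of \<open>z\<close> that fix a conjugacy class\<close>

text \<open>Translation by the central \<open>z\<close> commutes with conjugation, so if it sends
  \<open>g\<close> to a conjugate of \<open>g\<close>, it maps the whole class of \<open>g\<close>
  onto itself.\<close>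

lemma semi_regular_no_conj:
  assumes sr: "semi_regular G z" and x: "x \<in> carrier G" and g: "g \<in> carrier G"
  shows "z \<otimes> g \<noteq> conj_by G x g"
proof
  assume eq: "z \<otimes> g = conj_by G x g"
  have z: "z \<in> center G" using sr by (simp add: semi_regular_def)
  note zc = centerD(1)[OF z]
  define C where "C = {conj_by G h g | h. h \<in> carrier G}"
  have "C = orbit G (\<lambda>g. \<lambda>h \<in> carrier G. g \<otimes> h \<otimes> inv g) g"
    using g by (simp add: orbit_def C_def conj_by_def)
  then have "C \<in> conjugacy_classes G"
    using g by (auto simp: conjugacy_classes_def orbits_def)
  moreover have "z <# C = C"
  proof (intro equalityI subsetI)
    fix y assume "y \<in> z <# C"
    then obtain h where h: "h \<in> carrier G" "y = z \<otimes> conj_by G h g"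
      by (auto simp: l_coset_def C_def)
    then have "y = conj_by G (h \<otimes> x) g"
      using x g by (simp add: conj_by_center_mult[OF z, symmetric] eq conj_by_mult)
    then show "y \<in> C" using h x by (auto simp: C_def)
  next
    fix y assume "y \<in> C"
    then obtain h where h: "h \<in> carrier G" "y = conj_by G h g" by (auto simp: C_def)
    \<comment> \<open>Undoing the conjugation by \<open>x\<close> in \<open>eq\<close> shows that
      \<open>g\<close> is \<open>z\<close> times one of its conjugates; this gives surjectivity of
      the translation on \<open>C\<close>.\<close>
    have "z \<otimes> conj_by G (inv x) g = g"
      using conj_by_inv_eq[OF x g _ eq] zc x g by (simp add: conj_by_center_mult[OF z])
    then have "y = z \<otimes> conj_by G (h \<otimes> inv x) g"
      using h x g by (simp add: conj_by_mult conj_by_center_mult[OF z, symmetric])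
    moreover have "conj_by G (h \<otimes> inv x) g \<in> C" using h x unfolding C_def by blast
    ultimately show "y \<in> z <# C" unfolding l_coset_def by blast
  qed
  ultimately show False using sr by (auto simp: semi_regular_def)
qed

text \<open>The exponents that fix the class of \<open>g\<close> are closed under multiples: each
  further conjugation by \<open>x\<close> contributes one more central factor
  \<open>z [^] k\<close>.\<close>

lemma int_pow_fixes_class_mult:
  assumes z: "z \<in> center G" and x: "x \<in> carrier G" and g: "g \<in> carrier G"
    and eq: "z [^] (k::int) \<otimes> g = conj_by G x g"
  shows "z [^] (k * int m) \<otimes> g = conj_by G (x [^] m) g"
proof (induction m)
  case 0
  then show ?case using g by simp
next
  case (Suc m)
  have zc: "z [^] j \<in> carrier G" for j :: int using centerD(1)[OF z] by simp
  have "conj_by G (x [^] Suc m) g = conj_by G (x [^] m) (z [^] k \<otimes> g)"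
    using x g by (simp add: conj_by_mult eq)
  also have "\<dots> = z [^] k \<otimes> (z [^] (k * int m) \<otimes> g)"
    using x g by (simp add: conj_by_center_mult[OF center_int_pow[OF z]] Suc.IH)
  also have "\<dots> = z [^] (k + k * int m) \<otimes> g"
    using centerD(1)[OF z] g zc by (simp add: int_pow_mult m_assoc)
  finally show ?case by (simp add: algebra_simps)
qed

text \<open>An exponent \<open>k\<close> prime to \<open>p\<close> is invertible modulo the order
  \<open>p ^ n\<close>. Some multiple of \<open>k\<close> is then congruent to 1, so
  \<open>z\<close> itself would fix the class, against semi-regularity.\<close>

lemma prime_dvd_if_int_pow_fixes_class:
  assumes sr: "semi_regular G z" and ord: "ord z = p ^ n" and p: "prime p"
    and x: "x \<in> carrier G" and g: "g \<in> carrier G"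
    and eq: "z [^] (k::int) \<otimes> g = conj_by G x g"
  shows "int p dvd k"
proof (rule ccontr)
  assume "\<not> int p dvd k"
  have z: "z \<in> center G" using sr by (simp add: semi_regular_def)
  note zc = centerD(1)[OF z]
  have pos: "0 < int (p ^ n)" using p by (simp add: prime_gt_0_nat)
  have "coprime (int p) k"
    using p \<open>\<not> int p dvd k\<close> by (simp add: prime_imp_coprime)
  then have "coprime k (int (p ^ n))"
    by (simp add: coprime_commute)
  then obtain u where u: "[k * u = 1] (mod int (p ^ n))"
    using cong_solve_coprime_int by blast
  \<comment> \<open>The inverse of \<open>k\<close> is replaced by its non-negative residue, because
    the conjugator is raised to a natural power.\<close>
  define m where "m = nat (u mod int (p ^ n))"
  have "int m = u mod int (p ^ n)"
    unfolding m_def using pos by simp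
  then have "[k * int m = 1] (mod int (p ^ n))"
    using u by (simp add: cong_def mod_mult_right_eq)
  then have "int (ord z) dvd k * int m - 1"
    by (simp add: ord cong_iff_dvd_diff)
  then have "z [^] (k * int m - 1) = \<one>"
    using zc by (simp add: int_pow_eq_id)
  then have "z [^] (k * int m - 1 + 1) = z"
    using zc by (subst int_pow_mult) simp_all
  then have "z [^] (k * int m) = z" by simp
  then have "z \<otimes> g = conj_by G (x [^] m) g"
    using int_pow_fixes_class_mult[OF z x g eq, of m] by simp
  then show False using semi_regular_no_conj[OF sr _ g] x by simp
qed

section \<open>The equivalence relation and its representatives\<close>

lemma conj_modulo_refl: "g \<in> carrier G \<Longrightarrow> conj_modulo G z g g"
  unfolding conj_modulo_def by (rule exI[of _ 0]) (auto intro!: bexI[of _ \<one>])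

lemma conj_modulo_sym:
  assumes z: "z \<in> center G" and g: "g \<in> carrier G" and "conj_modulo G z g h"
  shows "conj_modulo G z h g"
proof -
  obtain k :: int and x where x: "x \<in> carrier G" and h: "h = z [^] k \<otimes> conj_by G x g"
    using assms by (auto simp: conj_modulo_def)
  note zc = centerD(1)[OF z]
  have "conj_by G (inv x) h = z [^] k \<otimes> g"
    using x g by (simp add: h conj_by_center_mult[OF center_int_pow[OF z]] conj_by_mult[symmetric])
  then have "z [^] (- k) \<otimes> conj_by G (inv x) h = g"
    using zc g by (simp add: m_assoc[symmetric] int_pow_mult[symmetric])
  then show ?thesis unfolding conj_modulo_def using x by (metis inv_closed)
qed

lemma conj_modulo_trans:
  assumes z: "z \<in> center G" and g: "g \<in> carrier G"
    and gh: "conj_modulo G z g h" and hl: "conj_modulo G z h l"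
  shows "conj_modulo G z g l"
proof -
  obtain k :: int and x where x: "x \<in> carrier G" and h: "h = z [^] k \<otimes> conj_by G x g"
    using gh by (auto simp: conj_modulo_def)
  obtain k' :: int and x' where x': "x' \<in> carrier G" and l: "l = z [^] k' \<otimes> conj_by G x' h"
    using hl by (auto simp: conj_modulo_def)
  have "l = z [^] (k' + k) \<otimes> conj_by G (x' \<otimes> x) g"
    using x x' g centerD(1)[OF z]
    by (simp add: l h conj_by_center_mult[OF center_int_pow[OF z]] conj_by_mult int_pow_mult m_assoc)
  then show ?thesis unfolding conj_modulo_def using x x' by blast
qed

lemma conj_modulo_class_rep:
  assumes "g \<in> carrier G"
  shows "conj_modulo G z g (class_rep G z g)"
  unfolding class_rep_def using conj_modulo_refl[OF assms] by (auto intro: someI)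

lemma class_rep_closed:
  assumes "z \<in> center G" "g \<in> carrier G"
  shows "class_rep G z g \<in> carrier G"
  using conj_modulo_class_rep[OF assms(2), of z] assms centerD(1)[OF assms(1)]
  by (auto simp: conj_modulo_def)

text \<open>By symmetry and transitivity, \<open>g\<close> and \<open>h\<close> are related to
  exactly the same elements, and both branches of \<open>class_rep\<close> depend on the element
  only through this predicate.\<close>

lemma class_rep_cong:
  assumes z: "z \<in> center G" and g: "g \<in> carrier G" and gh: "conj_modulo G z g h"
  shows "class_rep G z g = class_rep G z h"
proof -
  have "h \<in> carrier G"
    using gh g centerD(1)[OF z] by (auto simp: conj_modulo_def)
  then have "conj_modulo G z g = conj_modulo G z h"
    using conj_modulo_trans[OF z] conj_modulo_sym[OF z] g gh by blast
  then show ?thesis by (simp add: class_rep_def)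
qed

lemma class_rep_one: "class_rep G z \<one> = \<one>"
  by (simp add: class_rep_def conj_modulo_refl)

lemma class_rep_int_pow_mult:
  assumes "z \<in> center G" "g \<in> carrier G"
  shows "class_rep G z (z [^] (k::int) \<otimes> g) = class_rep G z g"
proof (rule class_rep_cong[OF assms, symmetric])
  show "conj_modulo G z g (z [^] k \<otimes> g)"
    unfolding conj_modulo_def using assms by (metis conj_by_one one_closed)
qed

lemma class_rep_conj_by:
  assumes "z \<in> center G" "g \<in> carrier G" "x \<in> carrier G"
  shows "class_rep G z (conj_by G x g) = class_rep G z g"
proof (rule class_rep_cong[OF assms(1,2), symmetric])
  have "conj_by G x g = z [^] (0::int) \<otimes> conj_by G x g"
    using assms by simp
  then show "conj_modulo G z g (conj_by G x g)"
    unfolding conj_modulo_def using assms by blast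
qed

section \<open>Normality of the two factors\<close>

lemma mem_class_factor_iff:
  "y \<in> class_factor G z p \<longleftrightarrow> y \<in> carrier G \<and>
     (\<exists>k::int. \<exists>x \<in> carrier G.
       y = z [^] (int p * k) \<otimes> conj_by G x (class_rep G z y))"
  unfolding class_factor_def by (rule mem_Collect_eq)

lemma class_factor_subset: "class_factor G z p \<subseteq> carrier G"
  unfolding class_factor_def by (rule Collect_restrict)

lemma class_factor_one: "\<one> \<in> class_factor G z p"
proof -
  have "\<one> = z [^] (int p * 0) \<otimes> conj_by G \<one> (class_rep G z \<one>)"
    by (simp add: class_rep_one)
  then show ?thesis unfolding mem_class_factor_iff by (metis one_closed)
qed

lemma class_rep_center_mult:
  assumes "z \<in> center G" "g \<in> carrier G" "x \<in> carrier G"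
  shows "class_rep G z (z [^] (k::int) \<otimes> conj_by G x g) = class_rep G z g"
  using assms by (simp add: class_rep_int_pow_mult class_rep_conj_by)

lemma normal_subset_power_factor:
  assumes "z \<in> center G"
  shows "normal_subset G (power_factor G z p)"
proof (rule normal_subsetI)
  show "power_factor G z p \<subseteq> carrier G"
    using centerD(1)[OF assms] by (auto simp: power_factor_def)
  fix x g assume x: "x \<in> power_factor G z p" and "g \<in> carrier G"
  moreover have "x \<in> center G"
    using x center_int_pow[OF assms] by (auto simp: power_factor_def)
  ultimately show "conj_by G g x \<in> power_factor G z p"
    by (simp add: conj_by_center)
qed

text \<open>Translating by a power of \<open>z\<close> and conjugating keep the representative, and
  the exponents stay multiples of \<open>p\<close>. The case \<open>j = 0\<close> gives normality;
  \<open>j = 1\<close> at \<open>\<one>\<close> puts the \<open>p\<close>-th power of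
  \<open>z\<close> into the factor.\<close>

lemma class_factor_closed:
  assumes z: "z \<in> center G" and y: "y \<in> class_factor G z p" and g: "g \<in> carrier G"
  shows "z [^] (int p * j) \<otimes> conj_by G g y \<in> class_factor G z p"
proof -
  note zc = centerD(1)[OF z]
  obtain k :: int and x where x: "x \<in> carrier G" and yc: "y \<in> carrier G"
    and eq: "y = z [^] (int p * k) \<otimes> conj_by G x (class_rep G z y)"
    using y unfolding mem_class_factor_iff by meson
  have r: "class_rep G z y \<in> carrier G" by (rule class_rep_closed[OF z yc])
  have "conj_by G g y = z [^] (int p * k) \<otimes> conj_by G (g \<otimes> x) (class_rep G z y)"
    using x g r by (subst eq) (simp add: conj_by_center_mult[OF center_int_pow[OF z]] conj_by_mult)
  then have "z [^] (int p * j) \<otimes> conj_by G g y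
      = z [^] (int p * (j + k)) \<otimes> conj_by G (g \<otimes> x) (class_rep G z y)"
    using zc x g r by (simp add: distrib_left int_pow_mult m_assoc)
  moreover have "class_rep G z (z [^] (int p * j) \<otimes> conj_by G g y) = class_rep G z y"
    by (rule class_rep_center_mult[OF z yc g])
  moreover have "z [^] (int p * j) \<otimes> conj_by G g y \<in> carrier G"
    using zc yc g by simp
  ultimately show ?thesis
    unfolding mem_class_factor_iff using x g by (metis m_closed)
qed

lemma normal_subset_class_factor:
  assumes z: "z \<in> center G"
  shows "normal_subset G (class_factor G z p)"
proof (rule normal_subsetI)
  show "class_factor G z p \<subseteq> carrier G" by (rule class_factor_subset)
  fix y g assume "y \<in> class_factor G z p" "g \<in> carrier G"
  moreover from this have "y \<in> carrier G" using class_factor_subset by blast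
  ultimately show "conj_by G g y \<in> class_factor G z p"
    using class_factor_closed[OF z, of y p g 0] by simp
qed

section \<open>Existence and uniqueness of the representation\<close>

text \<open>Write \<open>g\<close> as \<open>z [^] k\<close> times a conjugate of its representative
  and divide \<open>k\<close> by \<open>p\<close>: the remainder gives the element of
  \<open>power_factor\<close>, the multiple of \<open>p\<close> goes with the conjugate into
  \<open>class_factor\<close>.\<close>

lemma factorization_exists:
  assumes z: "z \<in> center G" and p: "p > 0" and g: "g \<in> carrier G"
  shows "\<exists>x \<in> power_factor G z p. \<exists>y \<in> class_factor G z p. g = x \<otimes> y"
proof -
  note zc = centerD(1)[OF z]
  define r where "r = class_rep G z g"
  have r: "r \<in> carrier G" unfolding r_def by (rule class_rep_closed[OF z g])
  have "conj_modulo G z r g"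
    unfolding r_def by (rule conj_modulo_sym[OF z g conj_modulo_class_rep[OF g]])
  then obtain k :: int and x where x: "x \<in> carrier G" and eq: "g = z [^] k \<otimes> conj_by G x r"
    by (auto simp: conj_modulo_def)
  define y where "y = z [^] (int p * (k div int p)) \<otimes> conj_by G x r"
  have "z [^] (k mod int p + int p * (k div int p)) = z [^] k" by simp
  then have gy: "g = z [^] (k mod int p) \<otimes> y"
    unfolding y_def eq using zc x r by (simp add: m_assoc[symmetric] int_pow_mult[symmetric])
  have yc: "y \<in> carrier G" using zc x r by (simp add: y_def)
  \<comment> \<open>Membership of \<open>y\<close> refers to its own representative; it is that of
    \<open>g\<close>, since the two differ by a power of \<open>z\<close>.\<close>
  have "class_rep G z y = r"
    unfolding r_def gy using yc by (rule class_rep_int_pow_mult[OF z, symmetric])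
  then have "y \<in> class_factor G z p"
    unfolding mem_class_factor_iff using yc x y_def by metis
  moreover have "z [^] (k mod int p) \<in> power_factor G z p"
    using p by (auto simp: power_factor_def)
  ultimately show ?thesis using gy by blast
qed

text \<open>Both \<open>y\<close> and \<open>y'\<close> come from one representative
  \<open>r\<close>, so the equation exhibits a power of \<open>z\<close> that fixes the class of
  \<open>r\<close>. Its exponent is divisible by \<open>p\<close>, hence so is
  \<open>i' - i\<close>; as both lie in \<open>[0, p)\<close> they agree, and cancellation does the
  rest.\<close>

lemma factorization_unique:
  assumes sr: "semi_regular G z" and ord: "ord z = p ^ n" and p: "prime p"
    and a: "a \<in> power_factor G z p" "a' \<in> power_factor G z p"
    and y: "y \<in> class_factor G z p" "y' \<in> class_factor G z p"
    and eq: "a \<otimes> y = a' \<otimes> y'"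
  shows "a = a' \<and> y = y'"
proof -
  have z: "z \<in> center G" using sr by (simp add: semi_regular_def)
  note zc = centerD(1)[OF z]
  obtain i i' :: int where i: "a = z [^] i" "0 \<le> i" "i < int p"
    and i': "a' = z [^] i'" "0 \<le> i'" "i' < int p"
    using a by (auto simp: power_factor_def)
  define r where "r = class_rep G z y"
  have yc: "y \<in> carrier G" "y' \<in> carrier G" using y class_factor_subset by blast+
  have r: "r \<in> carrier G" unfolding r_def by (rule class_rep_closed[OF z yc(1)])
  \<comment> \<open>Both representatives equal that of the common product, from which
    \<open>y\<close> and \<open>y'\<close> differ only by powers of \<open>z\<close>.\<close>
  have "class_rep G z y' = r"
    using class_rep_int_pow_mult[OF z yc(1), of i] class_rep_int_pow_mult[OF z yc(2), of i'] eq
    by (simp add: r_def i i')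
  then obtain k k' :: int and x x' where x: "x \<in> carrier G" "x' \<in> carrier G"
    and yk: "y = z [^] (int p * k) \<otimes> conj_by G x r"
    and yk': "y' = z [^] (int p * k') \<otimes> conj_by G x' r"
    using y unfolding mem_class_factor_iff r_def by metis
  \<comment> \<open>Conjugating the equation by \<open>inv x'\<close> frees \<open>r\<close> on the
    right and leaves \<open>w\<close> as the only conjugator on the left.\<close>
  define w where "w = inv x' \<otimes> x"
  have w: "w \<in> carrier G" using x by (simp add: w_def)
  have "z [^] (i + int p * k) \<otimes> conj_by G x r = z [^] (i' + int p * k') \<otimes> conj_by G x' r"
    using eq zc x r by (simp add: i i' yk yk' m_assoc int_pow_mult)
  then have "conj_by G (inv x') (z [^] (i + int p * k) \<otimes> conj_by G x r)
      = conj_by G (inv x') (z [^] (i' + int p * k') \<otimes> conj_by G x' r)"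
    by simp
  then have "z [^] (i + int p * k) \<otimes> conj_by G w r = z [^] (i' + int p * k') \<otimes> r"
    using x r by (simp add: conj_by_center_mult[OF center_int_pow[OF z]]
        conj_by_mult[symmetric] w_def)
  then have "z [^] (- (i + int p * k)) \<otimes> (z [^] (i + int p * k) \<otimes> conj_by G w r)
     = z [^] (- (i + int p * k)) \<otimes> (z [^] (i' + int p * k') \<otimes> r)"
    by simp
  then have "z [^] (- (i + int p * k) + (i' + int p * k')) \<otimes> r = conj_by G w r"
    using zc w r by (simp add: m_assoc[symmetric] int_pow_mult[symmetric])
  then have "int p dvd - (i + int p * k) + (i' + int p * k')"
    by (rule prime_dvd_if_int_pow_fixes_class[OF sr ord p w r])
  moreover have "- (i + int p * k) + (i' + int p * k') = (i' - i) + int p * (k' - k)"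
    by (simp add: algebra_simps)
  ultimately have "int p dvd i' - i"
    by (metis dvd_add_left_iff dvd_triv_left)
  then have "i mod int p = i' mod int p"
    by (simp add: mod_eq_dvd_iff dvd_diff_commute)
  then have "i = i'"
    using i i' by simp
  then show ?thesis using eq zc yc by (simp add: i i')
qed

lemma set_direct_factorization_class_factor:
  assumes sr: "semi_regular G z" and ord: "ord z = p ^ n" and p: "prime p"
  shows "set_direct_factorization G (power_factor G z p) (class_factor G z p)"
proof -
  have z: "z \<in> center G" using sr by (simp add: semi_regular_def)
  have p0: "p > 0" using p by (simp add: prime_gt_0_nat)
  have "\<exists>!(a, y). a \<in> power_factor G z p \<and> y \<in> class_factor G z p \<and> g = a \<otimes> y"
    if g: "g \<in> carrier G" for g
  proof -
    obtain a y where "a \<in> power_factor G z p" "y \<in> class_factor G z p" "g = a \<otimes> y"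
      using factorization_exists[OF z p0 g] by blast
    then show ?thesis
      using factorization_unique[OF sr ord p] by (intro ex1I[of _ "(a, y)"]) auto
  qed
  moreover have "power_factor G z p \<noteq> {}"
    using p0 by (force simp: power_factor_def)
  moreover have "class_factor G z p \<noteq> {}"
    using class_factor_one by blast
  ultimately show ?thesis
    using normal_subset_power_factor[OF z] normal_subset_class_factor[OF z]
    by (simp add: set_direct_factorization_def)
qed

section \<open>Excluding trivial factors and subgroups\<close>

text \<open>For \<open>0 \<le> i < p\<close> the difference \<open>p - i\<close> lies strictly
  between 0 and the order of \<open>z\<close>. This power of \<open>z\<close> later witnesses that
  \<open>power_factor\<close> is not a subgroup and that \<open>class_factor\<close> is not a
  singleton.\<close>

lemma int_pow_prime_not_mem_power_factor:
  assumes z: "z \<in> carrier G" and ord: "int p < int (ord z)" and p: "p > 0"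
  shows "z [^] int p \<notin> power_factor G z p"
proof
  assume "z [^] int p \<in> power_factor G z p"
  then obtain i :: int where i: "0 \<le> i" "i < int p" and eq: "z [^] int p = z [^] i"
    unfolding power_factor_def by blast
  then have "z [^] (int p - i) = \<one>"
    using z by (metis int_pow_diff int_pow_closed r_inv)
  then have "int (ord z) dvd int p - i" using z by (simp add: int_pow_eq_id)
  then show False using i ord zdvd_imp_le[of "int (ord z)" "int p - i"] by simp
qed

text \<open>The central \<open>a\<close> acts trivially by conjugation, and the central
  \<open>b\<close> can be moved next to \<open>inv b\<close>.\<close>

lemma commutator_center_mult:
  assumes a: "a \<in> center G" and b: "b \<in> center G" and x: "x \<in> carrier G" and y: "y \<in> carrier G"
  shows "(a \<otimes> x) \<otimes> (b \<otimes> y) \<otimes> inv (a \<otimes> x) \<otimes> inv (b \<otimes> y) = x \<otimes> y \<otimes> inv x \<otimes> inv y"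
proof -
  note ac = centerD(1)[OF a] and bc = centerD(1)[OF b]
  have "(a \<otimes> x) \<otimes> (b \<otimes> y) \<otimes> inv (a \<otimes> x) = conj_by G (a \<otimes> x) (b \<otimes> y)"
    by (simp add: conj_by_def)
  also have "\<dots> = conj_by G a (b \<otimes> conj_by G x y)"
    using ac bc x y by (simp add: conj_by_mult conj_by_center_mult[OF b])
  also have "\<dots> = b \<otimes> conj_by G x y"
    using ac bc x y by (simp add: conj_by_def centerD(2)[OF a] m_assoc)
  finally have "(a \<otimes> x) \<otimes> (b \<otimes> y) \<otimes> inv (a \<otimes> x) \<otimes> inv (b \<otimes> y)
     = b \<otimes> conj_by G x y \<otimes> (inv y \<otimes> inv b)"
    using bc y by (simp add: inv_mult_group)
  also have "\<dots> = conj_by G x y \<otimes> b \<otimes> (inv b \<otimes> inv y)"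
    using bc x y centerD(2)[OF b] centerD(2)[OF subgroup.m_inv_closed[OF subgroup_center b]]
    by simp
  also have "\<dots> = conj_by G x y \<otimes> inv y"
    using bc x y by (simp add: m_assoc) (simp add: m_assoc[symmetric])
  finally show ?thesis by (simp add: conj_by_def)
qed

text \<open>Central factors drop out of commutators, so every commutator of the group is already a
  commutator of elements of \<open>H\<close>.\<close>

lemma derived_subset_of_central_cofactor:
  assumes H: "subgroup H G"
    and gen: "\<And>g. g \<in> carrier G \<Longrightarrow> \<exists>a \<in> center G. \<exists>h \<in> H. g = a \<otimes> h"
  shows "derived G (carrier G) \<subseteq> H"
  unfolding derived_def
proof (rule generate_subgroup_incl[OF _ H], clarify)
  fix g g' assume "g \<in> carrier G" "g' \<in> carrier G"
  then obtain a h b h' where "a \<in> center G" "b \<in> center G" and h: "h \<in> H" "h' \<in> H"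
    and "g = a \<otimes> h" "g' = b \<otimes> h'"
    using gen by meson
  then have "g \<otimes> g' \<otimes> inv g \<otimes> inv g' = h \<otimes> h' \<otimes> inv h \<otimes> inv h'"
    using commutator_center_mult subgroup.mem_carrier[OF H] by simp
  then show "g \<otimes> g' \<otimes> inv g \<otimes> inv g' \<in> H"
    using h H by (simp add: subgroup.m_closed subgroup.m_inv_closed)
qed

end

theorem corollary1p10:
  fixes G :: "('a, 'b) monoid_scheme" and z :: 'a
  assumes "group G"
    and "z \<in> center G"
    and "z \<noteq> \<one>\<^bsub>G\<^esub>"
    and "primepow (group.ord G z)"
    and "\<not> Factorial_Ring.prime (group.ord G z)"
    and "semi_regular G z"
  shows "(\<exists>X Y. nontrivial_factorization G X Y) \<and>
         (perfect_group G \<longrightarrow>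
           (\<exists>X Y. nontrivial_factorization G X Y \<and> normalized_factorization G X Y \<and>
                  \<not> subgroup X G \<and> \<not> subgroup Y G))"
proof -
  interpret group G by fact
  note z = assms(2) and sr = assms(6)
  note zc = centerD(1)[OF z]
  obtain p n where p: "prime p" and n: "n > 0" and ord: "ord z = p ^ n"
    using assms(4) by (auto simp: primepow_def)
  have p2: "p \<ge> 2" using p by (rule prime_ge_2_nat)
  \<comment> \<open>This is where a non-prime order enters: it makes the order of \<open>z\<close>
    exceed \<open>p\<close>, so that the \<open>p\<close>-th power of \<open>z\<close> falls outside
    \<open>X\<close>.\<close>
  have "n \<noteq> 1" using assms(5) p ord by auto
  then have "n > 1" using n by simp
  then have lt: "int p < int (ord z)"
    using p2 power_strict_increasing[of 1 n p] by (simp add: ord)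
  define X where "X = power_factor G z p"
  define Y where "Y = class_factor G z p"
  have fact: "set_direct_factorization G X Y"
    unfolding X_def Y_def by (rule set_direct_factorization_class_factor[OF sr ord p])
  have X1: "\<one>\<^bsub>G\<^esub> \<in> X"
    using p2 by (auto simp: X_def power_factor_def intro!: exI[of _ 0])
  have Xz: "z \<in> X"
    using p2 zc by (auto simp: X_def power_factor_def intro!: exI[of _ 1] int_pow_1[symmetric])
  have Y1: "\<one>\<^bsub>G\<^esub> \<in> Y" unfolding Y_def by (rule class_factor_one)
  have zp: "z [^]\<^bsub>G\<^esub> int p \<notin> X"
    unfolding X_def using p2 by (intro int_pow_prime_not_mem_power_factor[OF zc lt]) simp
  have Yzp: "z [^]\<^bsub>G\<^esub> int p \<in> Y"
    using class_factor_closed[OF z class_factor_one one_closed, of p 1] zc by (simp add: Y_def)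
  \<comment> \<open>\<open>X\<close> contains \<open>\<one>\<close> and \<open>z\<close>;
    \<open>Y\<close> contains \<open>\<one>\<close> and the \<open>p\<close>-th power of
    \<open>z\<close>, which differ because only the former lies in \<open>X\<close>. So neither is a
    singleton.\<close>
  have nontriv: "nontrivial_factorization G X Y"
    unfolding nontrivial_factorization_def
    using fact X1 Xz Y1 Yzp zp assms(3) by (metis singletonD)
  \<comment> \<open>A subgroup containing \<open>z\<close> would contain its \<open>p\<close>-th
    power.\<close>
  have "\<not> subgroup X G"
    using subgroup_int_pow_closed[OF _ Xz] zp by blast
  moreover have "\<not> subgroup Y G" if perf: "perfect_group G"
  proof
    assume Y: "subgroup Y G"
    have "derived G (carrier G) \<subseteq> Y"
    proof (rule derived_subset_of_central_cofactor[OF Y])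
      fix g assume "g \<in> carrier G"
      then obtain a y where "a \<in> X" "y \<in> Y" "g = a \<otimes>\<^bsub>G\<^esub> y"
        using factorization_exists[OF z, of p g] p2 by (auto simp: X_def Y_def)
      then show "\<exists>a \<in> center G. \<exists>y \<in> Y. g = a \<otimes>\<^bsub>G\<^esub> y"
        using center_int_pow[OF z] by (auto simp: X_def power_factor_def)
    qed
    then have "z \<in> Y" using perf zc by (auto simp: perfect_group_def)
    \<comment> \<open>With \<open>z\<close> in both factors, these are two representations of
      \<open>z\<close>, which uniqueness forces to coincide.\<close>
    moreover have "z \<otimes>\<^bsub>G\<^esub> \<one>\<^bsub>G\<^esub> = \<one>\<^bsub>G\<^esub> \<otimes>\<^bsub>G\<^esub> z"
      using zc by simp
    ultimately have "z = \<one>\<^bsub>G\<^esub>"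
      using factorization_unique[OF sr ord p] X1 Xz Y1 unfolding X_def Y_def by blast
    then show False using assms(3) by simp
  qed
  moreover have "normalized_factorization G X Y"
    using fact X1 Y1 by (simp add: normalized_factorization_def)
  ultimately show ?thesis using nontriv by blast
qed

end
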